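(* Let $(d_1,\ldots,d_n)$ be the degree sequence of a simple undirected graph on $n$ vertices, with all $d_i\ge1$, and consider the maximum likelihood (ML) equations $$d_i=\sum_{j\ne i}\frac{e^{\hat\beta_i+\hat\beta_j}}{1+e^{\hat\beta_i+\hat\beta_j}},\qquad i=1,\ldots,n,$$ in the unknown $\hat{\boldsymbol{\beta}}=(\hat\beta_1,\ldots,\hat\beta_n)\in\mathbb{R}^n$. Let $\varphi=(\varphi_1,\ldots,\varphi_n):\mathbb{R}^n\to\mathbb{R}^n$ be given by $$\varphi_i(\mathbf{x}):=\log d_i-\log\sum_{j\ne i}\frac{1}{e^{-x_j}+e^{x_i}} .$$ Suppose the ML equations have a solution $\hat{\boldsymbol{\beta}}$. Then $\hat{\boldsymbol{\beta}}$ is a fixed point of the function $\varphi$. Starting from any $\mathbf{x}_0\in\mathbb{R}^n$, define $\mathbf{x}_{k+1}=\varphi(\mathbf{x}_k)$ for $k=0,1,2,\ldots$. Then $\mathbf{x}_k$ converges to $\hat{\boldsymbol{\beta}}$ geometrically fast in the $L^\infty$ norm, where the rate depends only on $(|\hat{\boldsymbol{\beta}}|_\infty,|\mathbf{x}_0|_\infty)$. In particular, $\hat{\boldsymbol{\beta}}$ must be the unique solution of the ML equations. Moreover, $$|\mathbf{x}_0-\hat{\boldsymbol{\beta}}|_\infty\le C\,|\mathbf{x}_0-\mathbf{x}_1|_\infty,$$ where $C$ is a continuous function of the pair $(|\hat{\boldsymbol{\beta}}|_\infty,|\mathbf{x}_0|_\infty)$. Conversely, if the ML equations do not have a solution, then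 the sequence $\{\mathbf{x}_k\}$ (defined by the same iteration from any $\mathbf{x}_0\in\mathbb{R}^n$) must have a divergent subsequence.
   Context: For $\mathbf{x}=(x_1,\ldots,x_n)\in\mathbb{R}^n$, $|\mathbf{x}|_\infty:=\max_{1\le i\le n}|x_i|$. "Geometrically fast with rate depending only on $(|\hat{\boldsymbol{\beta}}|_\infty,|\mathbf{x}_0|_\infty)$" means that there are $K<\infty$ and $\theta\in(0,1)$, depending only on this pair, with $|\mathbf{x}_k-\hat{\boldsymbol{\beta}}|_\infty\le K\theta^k$ for all $k\ge0$. *)

theory Defs
  imports Complex_Main "Jordan_Normal_Form.Matrix"
begin

text \<open>
  Vectors of dimension \<open>n\<close> are elements of \<open>carrier_vec n\<close>, so coordinates are
  indexed by \<open>0, \<dots>, n - 1\<close>. The dimension is a natural number (not a type) because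
  constants that are uniform in \<open>n\<close> have to be quantified before \<open>n\<close>.
\<close>

text \<open>Only meaningful for \<open>dim_vec x > 0\<close>, the maximum being over a nonempty set.\<close>

definition linf_norm :: "real vec \<Rightarrow> real" where
  "linf_norm x = Max ((\<lambda>i. \<bar>x $ i\<bar>) ` {..<dim_vec x})"

text \<open>A simple undirected graph is given by its set of edges, which are 2-element sets of vertices.\<close>

definition simple_graph :: "'v set \<Rightarrow> 'v set set \<Rightarrow> bool" where
  "simple_graph V E \<longleftrightarrow> finite V \<and> (\<forall>e\<in>E. e \<subseteq> V \<and> card e = 2)"

definition degree_in :: "'v set set \<Rightarrow> 'v \<Rightarrow> nat" where
  "degree_in E v = card {e \<in> E. v \<in> e}"

definition degree_sequence :: "nat \<Rightarrow> nat vec \<Rightarrow> bool" where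
  "degree_sequence n d \<longleftrightarrow>
     (\<exists>E. simple_graph {..<n} E \<and> d = vec n (degree_in E))"

definition solves_ML :: "nat \<Rightarrow> nat vec \<Rightarrow> real vec \<Rightarrow> bool" where
  "solves_ML n d \<beta> \<longleftrightarrow> \<beta> \<in> carrier_vec n \<and>
     (\<forall>i<n. real (d $ i) = (\<Sum>j\<in>{..<n} - {i}. exp (\<beta> $ i + \<beta> $ j) / (1 + exp (\<beta> $ i + \<beta> $ j))))"

definition phi :: "nat \<Rightarrow> nat vec \<Rightarrow> real vec \<Rightarrow> real vec" where
  "phi n d x = vec n (\<lambda>i. ln (real (d $ i))
     - ln (\<Sum>j\<in>{..<n} - {i}. 1 / (exp (- (x $ j)) + exp (x $ i))))"

definition iterate :: "nat \<Rightarrow> nat vec \<Rightarrow> real vec \<Rightarrow> nat \<Rightarrow> real vec" where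
  "iterate n d x0 k = (phi n d ^^ k) x0"

end

theory Submission
  imports Defs
begin

text \<open>
  Two applications of \<^const>\<open>phi\<close> contract the supremum norm, by a factor that does not depend
  on the dimension; everything else follows from this.

  Write \<open>\<phi>\<close> for \<^const>\<open>phi\<close>. In each row of its Jacobian the diagonal entry is positive, all other
  entries are negative, and the absolute values sum to \<open>1\<close>. By the mean value theorem, each
  coordinate of \<open>\<phi>(x) - \<phi>(y)\<close> therefore has the form \<open>a v\<^sub>i - (\<Sum>j\<noteq>i. b\<^sub>j v\<^sub>j)\<close> with \<open>v = x - y\<close> and
  weights adding up to \<open>1\<close> (\<open>phi_diff_alternating_mean\<close>). So \<open>\<phi>\<close> never increases distances, but one
  step need not decrease them: nothing is lost when \<open>v\<^sub>i = D\<close> and \<open>v\<^sub>j = - D\<close> for all \<open>j \<noteq> i\<close>. This is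
  the only extremal pattern up to sign, and \<open>w = \<phi>(x) - \<phi>(y)\<close> cannot have it as well: \<open>w\<^sub>i = D\<close> needs
  \<open>v\<^sub>k = - D\<close> for all \<open>k \<noteq> i\<close>, while \<open>w\<^sub>j = - D\<close> with \<open>j \<noteq> i\<close> needs \<open>v\<^sub>k = D\<close> for all \<open>k \<noteq> j\<close>, and these
  two conflict as soon as there is an index \<open>k\<close> other than \<open>i\<close> and \<open>j\<close>. If all arguments have norm at most \<open>R\<close>, then
  the diagonal weights are at least some \<open>\<delta>(R) > 0\<close> and the others at least \<open>\<delta>(R) / (n - 1)\<close>; with
  these bounds, for \<open>n \<ge> 3\<close>, the conflict costs a factor \<open>1 - \<delta>(R)\<^sup>2\<close> over two steps
  (\<open>alternating_mean_twice_le\<close>).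

  For \<open>n \<ge> 2\<close> the solutions of the equations are exactly the fixed points of \<open>\<phi>\<close>, and solutions exist
  only for \<open>n \<ge> 3\<close>.
  Starting at \<open>x\<close>, all iterates stay within distance \<open>|x| + |\<beta>|\<close> of a solution \<open>\<beta>\<close>, so
  \<open>R = 2 |\<beta>| + |x|\<close> bounds them and gives a rate; uniqueness and the a posteriori bound on
  \<open>|x - \<beta>|\<close> come from the same two-step estimate. Conversely, if the iterates stay bounded and
  \<open>n \<ge> 3\<close>, the contraction applied to consecutive iterates makes the sequence converge, and its
  limit is a fixed point. For \<open>n = 2\<close> there is no contraction, but the iterates are seen to be
  unbounded directly (\<open>iterate_two_unbounded\<close>).
\<close>

section \<open>The supremum norm\<close>

lemma abs_index_le_linf_norm:
  assumes "x \<in> carrier_vec n" "i < n"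
  shows "\<bar>x $ i\<bar> \<le> linf_norm x"
  using assms unfolding linf_norm_def by (intro Max_ge) auto

lemma linf_norm_leI:
  assumes "x \<in> carrier_vec n" "1 \<le> n" "\<And>i. i < n \<Longrightarrow> \<bar>x $ i\<bar> \<le> B"
  shows "linf_norm x \<le> B"
  using assms unfolding linf_norm_def by (subst Max_le_iff) (auto simp: lessThan_empty_iff)

lemma linf_norm_nonneg:
  assumes "x \<in> carrier_vec n" "1 \<le> n"
  shows "0 \<le> linf_norm x"
  using abs_index_le_linf_norm[of x n 0] assms by auto

lemma abs_diff_index_le_linf_norm:
  assumes "x \<in> carrier_vec n" "y \<in> carrier_vec n" "i < n"
  shows "\<bar>x $ i - y $ i\<bar> \<le> linf_norm (x - y)"
  using abs_index_le_linf_norm[of "x - y" n i] assms by auto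

lemma linf_norm_diff_leI:
  assumes "x \<in> carrier_vec n" "y \<in> carrier_vec n" "1 \<le> n"
    and "\<And>i. i < n \<Longrightarrow> \<bar>x $ i - y $ i\<bar> \<le> B"
  shows "linf_norm (x - y) \<le> B"
  by (rule linf_norm_leI[of _ n]) (use assms in auto)

lemma linf_norm_diff_triangle:
  assumes "x \<in> carrier_vec n" "y \<in> carrier_vec n" "z \<in> carrier_vec n" "1 \<le> n"
  shows "linf_norm (x - z) \<le> linf_norm (x - y) + linf_norm (y - z)"
proof (rule linf_norm_diff_leI[of _ n])
  fix i assume "i < n"
  then show "\<bar>x $ i - z $ i\<bar> \<le> linf_norm (x - y) + linf_norm (y - z)"
    using abs_diff_index_le_linf_norm[of x n y i] abs_diff_index_le_linf_norm[of y n z i] assms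
    by auto
qed (use assms in auto)

lemma linf_norm_diff_le:
  assumes "x \<in> carrier_vec n" "y \<in> carrier_vec n" "1 \<le> n"
  shows "linf_norm (x - y) \<le> linf_norm x + linf_norm y"
proof (rule linf_norm_diff_leI[of _ n])
  fix i assume "i < n"
  then show "\<bar>x $ i - y $ i\<bar> \<le> linf_norm x + linf_norm y"
    using abs_index_le_linf_norm[of x n i] abs_index_le_linf_norm[of y n i] assms by auto
qed (use assms in auto)

lemma linf_norm_le_diff_plus:
  assumes "x \<in> carrier_vec n" "y \<in> carrier_vec n" "1 \<le> n"
  shows "linf_norm x \<le> linf_norm (x - y) + linf_norm y"
proof (rule linf_norm_leI[of _ n])
  fix i assume "i < n"
  then show "\<bar>x $ i\<bar> \<le> linf_norm (x - y) + linf_norm y"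
    using abs_diff_index_le_linf_norm[of x n y i] abs_index_le_linf_norm[of y n i] assms by auto
qed (use assms in auto)

section \<open>Alternating means\<close>

text \<open>
  The form of a coordinate of \<open>\<phi>(x) - \<phi>(y)\<close>, where \<open>v = x - y\<close>: a convex combination of \<open>v\<^sub>i\<close> and
  of the values \<open>- v\<^sub>j\<close> for \<open>j \<noteq> i\<close>. The off-diagonal weights have the lower bound \<open>\<delta> / (n - 1)\<close>
  because \<open>n - 1\<close> of them share a total of at most \<open>1\<close>.
\<close>

definition alternating_mean :: "real \<Rightarrow> nat \<Rightarrow> (nat \<Rightarrow> real) \<Rightarrow> nat \<Rightarrow> real \<Rightarrow> bool" where
  "alternating_mean \<delta> n v i c \<longleftrightarrow>
     (\<exists>a b. \<delta> \<le> a \<and> (\<forall>j\<in>{..<n} - {i}. \<delta> / (real n - 1) \<le> b j) \<and>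
        a + (\<Sum>j\<in>{..<n} - {i}. b j) = 1 \<and>
        c = a * v i - (\<Sum>j\<in>{..<n} - {i}. b j * v j))"

lemma alternating_mean_uminus:
  assumes "alternating_mean \<delta> n v i c"
  shows "alternating_mean \<delta> n (\<lambda>j. - v j) i (- c)"
proof -
  from assms obtain a b where
    "\<delta> \<le> a" "\<forall>j\<in>{..<n} - {i}. \<delta> / (real n - 1) \<le> b j"
    "a + (\<Sum>j\<in>{..<n} - {i}. b j) = 1" "c = a * v i - (\<Sum>j\<in>{..<n} - {i}. b j * v j)"
    unfolding alternating_mean_def by blast
  then show ?thesis
    unfolding alternating_mean_def
    by (intro exI[of _ a] exI[of _ b]) (simp add: sum_negf)
qed

text \<open>
  Since the weights add up to \<open>1\<close>, the deficit \<open>D - c\<close> is the same weighted sum of the deficits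
  \<open>D - v\<^sub>i\<close> and \<open>D - (- v\<^sub>j)\<close>. These are nonnegative, so every weight may be lowered to its bound.
\<close>

lemma alternating_mean_upper_gap:
  assumes "alternating_mean \<delta> n v i c" "i < n" "\<And>j. j < n \<Longrightarrow> \<bar>v j\<bar> \<le> D"
  shows "\<delta> * (D - v i) + \<delta> / (real n - 1) * (\<Sum>j\<in>{..<n} - {i}. D + v j) \<le> D - c"
proof -
  let ?J = "{..<n} - {i}"
  from assms(1) obtain a b where a: "\<delta> \<le> a"
    and b: "\<forall>j\<in>?J. \<delta> / (real n - 1) \<le> b j"
    and one: "a + (\<Sum>j\<in>?J. b j) = 1" and c: "c = a * v i - (\<Sum>j\<in>?J. b j * v j)"
    unfolding alternating_mean_def by blast
  have "D - c = D * (a + (\<Sum>j\<in>?J. b j)) - c"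
    using one by simp
  also have "\<dots> = a * (D - v i) + (\<Sum>j\<in>?J. b j * (D + v j))"
    unfolding c by (simp add: algebra_simps sum.distrib sum_distrib_left)
  finally have eq: "D - c = a * (D - v i) + (\<Sum>j\<in>?J. b j * (D + v j))" .
  have "\<delta> * (D - v i) \<le> a * (D - v i)"
    using a assms(2) assms(3)[of i] by (intro mult_right_mono) auto
  moreover have "(\<Sum>j\<in>?J. \<delta> / (real n - 1) * (D + v j)) \<le> (\<Sum>j\<in>?J. b j * (D + v j))"
  proof (rule sum_mono)
    fix j assume "j \<in> ?J"
    then show "\<delta> / (real n - 1) * (D + v j) \<le> b j * (D + v j)"
      using b assms(3)[of j] by (intro mult_right_mono) auto
  qed
  ultimately show ?thesis
    unfolding eq by (simp add: sum_distrib_left)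
qed

lemma alternating_mean_le:
  assumes "alternating_mean \<delta> n v i c" "i < n" "0 \<le> \<delta>" "\<And>j. j < n \<Longrightarrow> \<bar>v j\<bar> \<le> D"
  shows "c \<le> D"
proof -
  have "0 \<le> \<delta> * (D - v i)"
    using assms(2,3) assms(4)[of i] by (intro mult_nonneg_nonneg) auto
  moreover have "0 \<le> \<delta> / (real n - 1) * (\<Sum>j\<in>{..<n} - {i}. D + v j)"
    using assms(2,3) assms(4) by (intro mult_nonneg_nonneg divide_nonneg_nonneg sum_nonneg)
      (force simp: abs_le_iff)+
  ultimately show ?thesis
    using alternating_mean_upper_gap[OF assms(1,2,4)] by simp
qed

lemma alternating_mean_abs_le:
  assumes "alternating_mean \<delta> n v i c" "i < n" "0 \<le> \<delta>" "\<And>j. j < n \<Longrightarrow> \<bar>v j\<bar> \<le> D"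
  shows "\<bar>c\<bar> \<le> D"
  using alternating_mean_le[OF assms]
    alternating_mean_le[OF alternating_mean_uminus[OF assms(1)] assms(2,3), of D] assms(4)
  by simp

text \<open>
  The deficit \<open>D - z\<close> is bounded below by the deficits of \<open>w\<close>, and these by the deficits of \<open>v\<close>.
  The term \<open>D - w\<^sub>i\<close> contributes multiples of \<open>D + v\<^sub>k\<close>, whereas the terms \<open>D + w\<^sub>j\<close> with \<open>j \<noteq> i\<close>
  contribute multiples of \<open>D - v\<^sub>k\<close>. Both kinds occur for every \<open>k \<noteq> i\<close>, and
  \<open>(D + v\<^sub>k) + (D - v\<^sub>k) = 2 D\<close> no matter what \<open>v\<close> is.
\<close>

lemma alternating_mean_twice_le:
  assumes n: "3 \<le> n" and i: "i < n" and \<delta>: "0 \<le> \<delta>"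
    and v: "\<And>j. j < n \<Longrightarrow> \<bar>v j\<bar> \<le> D"
    and w: "\<And>j. j < n \<Longrightarrow> alternating_mean \<delta> n v j (w j)"
    and z: "alternating_mean \<delta> n w i z"
  shows "z \<le> (1 - \<delta>\<^sup>2) * D"
proof -
  define J where "J = {..<n} - {i}"
  define N where "N = real n - 1"
  define U where "U = (\<Sum>k\<in>J. D + v k)"
  define T where "T = (\<Sum>k\<in>J. D - v k)"
  have N: "2 \<le> N" "real (card J) = N"
    using n i by (auto simp: N_def J_def)
  have w_le: "\<bar>w j\<bar> \<le> D" if "j < n" for j
    using alternating_mean_abs_le[OF w[OF that] that \<delta> v] .
  have "0 \<le> T" "U + T = 2 * N * D"
    using v N by (auto simp: T_def U_def J_def abs_le_iff simp flip: sum.distrib intro!: sum_nonneg)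
  have "0 \<le> \<delta> * (D - v i)"
    using \<delta> v[OF i] by (intro mult_nonneg_nonneg) auto
  then have gap_i: "\<delta> / N * U \<le> D - w i"
    using alternating_mean_upper_gap[OF w[OF i] i v] by (simp add: U_def N_def J_def)
  have gap_j: "\<delta> / N * (T - (D - v j)) \<le> D + w j" if "j \<in> J" for j
  proof -
    have j: "j < n" "j \<noteq> i" using that by (auto simp: J_def)
    have "T - (D - v j) = (\<Sum>k\<in>J - {j}. D - v k)"
      using that by (simp add: T_def sum_diff1 J_def)
    also have "\<dots> \<le> (\<Sum>k\<in>{..<n} - {j}. D - v k)"
      using v by (intro sum_mono2) (auto simp: J_def abs_le_iff)
    finally have "\<delta> / N * (T - (D - v j)) \<le> \<delta> / N * (\<Sum>k\<in>{..<n} - {j}. D - v k)"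
      using \<delta> N by (intro mult_left_mono) auto
    moreover have "0 \<le> \<delta> * (D + v j)"
      using \<delta> v[OF j(1)] by (intro mult_nonneg_nonneg) auto
    ultimately show ?thesis
      using alternating_mean_upper_gap[OF alternating_mean_uminus[OF w[OF j(1)]] j(1), of D] v
      by (simp add: N_def)
  qed
  \<comment> \<open>Each \<open>k\<close> is counted once for every \<open>j\<close> other than \<open>i\<close> and \<open>k\<close>, that is \<open>n - 2 = N - 1\<close> times.\<close>
  have "(\<Sum>j\<in>J. T - (D - v j)) = (\<Sum>j\<in>J. T) - T"
    unfolding T_def by (rule sum_subtractf)
  also have "\<dots> = (N - 1) * T"
    using N by (simp add: algebra_simps)
  finally have "\<delta> / N * ((N - 1) * T) = (\<Sum>j\<in>J. \<delta> / N * (T - (D - v j)))"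
    by (simp only: sum_distrib_left[symmetric])
  also have "\<dots> \<le> (\<Sum>j\<in>J. D + w j)"
    by (rule sum_mono) (rule gap_j)
  finally have sum_gap: "\<delta> / N * ((N - 1) * T) \<le> (\<Sum>j\<in>J. D + w j)" .
  have "\<delta>\<^sup>2 * D = \<delta> * (\<delta> / N * (1/2 * (U + T)))"
    using \<open>U + T = 2 * N * D\<close> N by (simp add: power2_eq_square)
  also have "\<dots> \<le> \<delta> * (\<delta> / N * U) + \<delta> / N * (\<delta> / N * ((N - 1) * T))"
  proof -
    have "0 \<le> D + v k" if "k \<in> J" for k
      using v[of k] that by (auto simp: J_def)
    then have "0 \<le> U"
      unfolding U_def by (rule sum_nonneg)
    \<comment> \<open>This is where \<open>n \<ge> 3\<close> enters: it makes \<open>(n - 2) / (n - 1)\<close> at least \<open>1/2\<close>.\<close>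
    moreover have "1/2 * T \<le> (N - 1) / N * T"
      using N \<open>0 \<le> T\<close> by (intro mult_right_mono) (auto simp: field_simps)
    ultimately have "1/2 * (U + T) \<le> U + (N - 1) / N * T"
      by simp
    then have "\<delta> * (\<delta> / N * (1/2 * (U + T))) \<le> \<delta> * (\<delta> / N * (U + (N - 1) / N * T))"
      using \<delta> N by (intro mult_left_mono) auto
    also have "\<dots> = \<delta> * (\<delta> / N * U) + \<delta> / N * (\<delta> / N * ((N - 1) * T))"
      using N by (simp add: field_simps)
    finally show ?thesis .
  qed
  also have "\<dots> \<le> \<delta> * (D - w i) + \<delta> / N * (\<Sum>j\<in>J. D + w j)"
    using \<delta> N gap_i sum_gap by (intro add_mono mult_left_mono) auto
  also have "\<dots> \<le> D - z"
    using alternating_mean_upper_gap[OF z i w_le] by (simp add: J_def N_def)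
  finally show ?thesis by (simp add: algebra_simps)
qed

lemma alternating_mean_twice_abs_le:
  assumes "3 \<le> n" "i < n" "0 \<le> \<delta>" and v: "\<And>j. j < n \<Longrightarrow> \<bar>v j\<bar> \<le> D"
    and w: "\<And>j. j < n \<Longrightarrow> alternating_mean \<delta> n v j (w j)"
    and z: "alternating_mean \<delta> n w i z"
  shows "\<bar>z\<bar> \<le> (1 - \<delta>\<^sup>2) * D"
proof -
  have "- z \<le> (1 - \<delta>\<^sup>2) * D"
    by (rule alternating_mean_twice_le[OF assms(1-3), of "\<lambda>j. - v j" D "\<lambda>j. - w j"])
      (use v w z in \<open>auto intro: alternating_mean_uminus\<close>)
  then show ?thesis
    using alternating_mean_twice_le[OF assms] by linarith
qed

section \<open>Differences of the map are alternating means\<close>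

lemma phi_carrier [simp]: "phi n d x \<in> carrier_vec n"
  by (simp add: phi_def)

lemma iterate_0 [simp]: "iterate n d x 0 = x"
  by (simp add: iterate_def)

lemma iterate_Suc: "iterate n d x (Suc k) = phi n d (iterate n d x k)"
  by (simp add: iterate_def)

lemma iterate_carrier [simp]: "x \<in> carrier_vec n \<Longrightarrow> iterate n d x k \<in> carrier_vec n"
  by (cases k) (auto simp: iterate_Suc)

lemma others_nonempty: "2 \<le> n \<Longrightarrow> {..<n} - {i :: nat} \<noteq> {}"
proof -
  assume "2 \<le> n"
  then have "0 \<in> {..<n} - {i} \<or> 1 \<in> {..<n} - {i}" by auto
  then show ?thesis by blast
qed

text \<open>
  The \<open>\<delta>(R)\<close> of the argument. A diagonal weight is a mean of logistic functions, each at least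
  \<open>exp (- 2 * R) / 2\<close>. An off-diagonal weight is such a logistic value multiplied by the share of one
  summand in a sum of \<open>n - 1\<close> summands whose ratios are at least \<open>exp (- 2 * R)\<close>.
\<close>

definition ellipticity :: "real \<Rightarrow> real" where
  "ellipticity R = exp (- 4 * R) / 2"

lemma logit_weight_bounds:
  fixes s t R :: real
  assumes "\<bar>s\<bar> \<le> R" "\<bar>t\<bar> \<le> R"
  shows "exp (- 2 * R) / 2 \<le> exp t / (exp (- s) + exp t)"
    and "exp (- 2 * R) / 2 \<le> exp (- s) / (exp (- s) + exp t)"
    and "exp (- R) / 2 \<le> 1 / (exp (- s) + exp t)"
    and "1 / (exp (- s) + exp t) \<le> exp R / 2"
proof -
  have pos: "0 < exp (- s) + exp t" by (simp add: add_pos_pos)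
  have up: "exp (- s) + exp t \<le> 2 * exp R"
    using assms by (smt (verit) exp_le_cancel_iff)
  have low: "2 * exp (- R) \<le> exp (- s) + exp t"
    using assms by (smt (verit) exp_le_cancel_iff)
  have q: "exp (- R) / 2 = 1 / (2 * exp R)" "exp R / 2 = 1 / (2 * exp (- R))"
    by (simp_all add: exp_minus field_simps)
  show 3: "exp (- R) / 2 \<le> 1 / (exp (- s) + exp t)"
    unfolding q using up pos by (intro divide_left_mono) auto
  show "1 / (exp (- s) + exp t) \<le> exp R / 2"
    unfolding q using low pos by (intro divide_left_mono) auto
  have sq: "exp (- 2 * R) / 2 = exp (- R) * (exp (- R) / 2)"
    by (simp flip: exp_add)
  have "exp (- R) * (exp (- R) / 2) \<le> exp t * (1 / (exp (- s) + exp t))"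
    using 3 assms by (intro mult_mono) auto
  then show "exp (- 2 * R) / 2 \<le> exp t / (exp (- s) + exp t)"
    unfolding sq by simp
  have "exp (- R) * (exp (- R) / 2) \<le> exp (- s) * (1 / (exp (- s) + exp t))"
    using 3 assms by (intro mult_mono) auto
  then show "exp (- 2 * R) / 2 \<le> exp (- s) / (exp (- s) + exp t)"
    unfolding sq by simp
qed

text \<open>
  The mean value theorem along the segment from \<open>y\<close> to \<open>x\<close>, for one coordinate at a time. The
  intermediate point depends on the coordinate, which is harmless because \<^const>\<open>alternating_mean\<close>
  constrains each row separately. The term \<open>ln (d $ i)\<close> cancels in the difference.
\<close>

lemma phi_diff_alternating_mean:
  assumes n: "2 \<le> n" and i: "i < n"
    and xc: "x \<in> carrier_vec n" and yc: "y \<in> carrier_vec n"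
    and x: "linf_norm x \<le> R" and y: "linf_norm y \<le> R"
  shows "alternating_mean (ellipticity R) n (\<lambda>j. x $ j - y $ j) i (phi n d x $ i - phi n d y $ i)"
proof -
  define J where "J = {..<n} - {i}"
  have J: "finite J" "J \<noteq> {}" "real (card J) = real n - 1"
    using n i others_nonempty[OF n, of i] by (auto simp: J_def)
  define v where "v j = x $ j - y $ j" for j
  define u where "u t j = y $ j + t * v j" for t j
  define g where "g t j = exp (- u t j) + exp (u t i)" for t j
  define S where "S t = (\<Sum>j\<in>J. 1 / g t j)" for t
  have g: "0 < g t j" for t j
    by (simp add: g_def add_pos_pos)
  have S: "0 < S t" for t
    unfolding S_def using J g by (intro sum_pos) auto
  define S' where "S' t = (\<Sum>j\<in>J. (v j * exp (- u t j) - v i * exp (u t i)) / (g t j)\<^sup>2)" for t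
  have derS: "(S has_real_derivative S' t) (at t)" for t
  proof -
    have du: "((\<lambda>t. u t j) has_real_derivative v j) (at t)" for j
      unfolding u_def by (auto intro!: derivative_eq_intros)
    have dg: "((\<lambda>t. g t j) has_real_derivative - v j * exp (- u t j) + v i * exp (u t i)) (at t)" for j
      unfolding g_def by (auto intro!: derivative_eq_intros du)
    have "((\<lambda>t. 1 / g t j) has_real_derivative
        (v j * exp (- u t j) - v i * exp (u t i)) / (g t j)\<^sup>2) (at t)" for j
      using DERIV_divide[OF DERIV_const[of 1] dg[of j]] g[of t j] by (simp add: power2_eq_square)
    then show ?thesis
      unfolding S_def[abs_def] S'_def by (intro DERIV_sum) auto
  qed
  have der: "((\<lambda>t. - ln (S t)) has_real_derivative - (S' t / S t)) (at t)" for t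
    using S[of t] by (auto intro!: derivative_eq_intros derS)
  obtain t where t: "0 < t" "t < 1"
    and mvt: "- ln (S 1) - - ln (S 0) = (1 - 0) * (- (S' t / S t))"
    using MVT2[of 0 1 "\<lambda>t. - ln (S t)" "\<lambda>t. - (S' t / S t)"] der by auto
  have diff: "phi n d x $ i - phi n d y $ i = - (S' t / S t)"
    using mvt i by (simp add: phi_def S_def g_def u_def v_def J_def)
  have uR: "\<bar>u t j\<bar> \<le> R" if "j < n" for j
  proof -
    have "\<bar>x $ j\<bar> \<le> R" "\<bar>y $ j\<bar> \<le> R"
      using abs_index_le_linf_norm[OF xc that] abs_index_le_linf_norm[OF yc that] x y by auto
    then have "\<bar>(1 - t) * y $ j + t * x $ j\<bar> \<le> (1 - t) * R + t * R"
      using t by (intro order_trans[OF abs_triangle_ineq] add_mono)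
        (auto simp: abs_mult intro!: mult_left_mono)
    then show ?thesis by (simp add: u_def v_def algebra_simps)
  qed
  \<comment> \<open>Differentiating the logarithm yields a mean over \<open>j\<close> with the weights \<open>p j\<close>. In it, each
    summand splits into a part for \<open>v i\<close> and a part for \<open>v j\<close>, with fractions that add up to \<open>1\<close>.\<close>
  define p where "p j = 1 / g t j / S t" for j
  have p_pos: "0 < p j" for j
    using g S by (simp add: p_def)
  have p_sum: "(\<Sum>j\<in>J. p j) = 1"
    using S[of t] unfolding p_def sum_divide_distrib[symmetric] S_def[symmetric] by simp
  have p_low: "exp (- 2 * R) / (real n - 1) \<le> p j" if j: "j \<in> J" for j
  proof -
    have "S t \<le> (\<Sum>j\<in>J. exp R / 2)"
      unfolding S_def g_def
      using uR i by (intro sum_mono logit_weight_bounds(4)) (auto simp: J_def)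
    then have S_up: "S t \<le> (real n - 1) * (exp R / 2)"
      using J by simp
    have "exp (- 2 * R) / (real n - 1) = (exp (- R) / 2) / ((real n - 1) * (exp R / 2))"
      by (simp add: exp_minus field_simps flip: exp_add exp_double)
    also have "\<dots> \<le> 1 / g t j / S t"
      unfolding g_def
      using uR i j S S_up n by (intro frac_le logit_weight_bounds(3)) (auto simp: J_def)
    finally show ?thesis by (simp add: p_def)
  qed
  define a where "a = (\<Sum>j\<in>J. p j * (exp (u t i) / g t j))"
  define b where "b j = p j * (exp (- u t j) / g t j)" for j
  have split1: "exp (u t i) / g t j + exp (- u t j) / g t j = 1" for j
    using g[of t j] by (simp add: g_def add_divide_distrib[symmetric] add.commute)
  have "a + (\<Sum>j\<in>J. b j) = (\<Sum>j\<in>J. p j * (exp (u t i) / g t j + exp (- u t j) / g t j))"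
    by (simp add: a_def b_def sum.distrib algebra_simps)
  also have "\<dots> = 1"
    using p_sum by (simp only: split1 mult_1_right)
  finally have one: "a + (\<Sum>j\<in>J. b j) = 1" .
  have R: "0 \<le> R"
    using uR[OF i] by linarith
  have e4: "exp (- 4 * R) = exp (- 2 * R) * exp (- 2 * R)"
    by (simp flip: exp_add)
  have "exp (- 2 * R) / 2 = (\<Sum>j\<in>J. p j * (exp (- 2 * R) / 2))"
    by (simp only: sum_distrib_right[symmetric] p_sum mult_1_left)
  also have "\<dots> \<le> a"
    unfolding a_def g_def using uR i p_pos
    by (intro sum_mono mult_left_mono logit_weight_bounds(1)) (auto simp: J_def less_imp_le)
  finally have "exp (- 2 * R) / 2 \<le> a" .
  moreover have "ellipticity R \<le> exp (- 2 * R) / 2"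
    using R by (simp add: ellipticity_def)
  ultimately have a_low: "ellipticity R \<le> a" by linarith
  have b_low: "ellipticity R / (real n - 1) \<le> b j" if j: "j \<in> J" for j
  proof -
    have "ellipticity R / (real n - 1) = exp (- 2 * R) / (real n - 1) * (exp (- 2 * R) / 2)"
      unfolding ellipticity_def e4 by simp
    also have "\<dots> \<le> b j"
      unfolding b_def g_def
      using uR i j p_pos[of j] by (intro mult_mono p_low logit_weight_bounds(2)) (auto simp: J_def)
    finally show ?thesis .
  qed
  have "- (S' t / S t) = (\<Sum>j\<in>J. p j * (exp (u t i) / g t j) * v i - b j * v j)"
    unfolding S'_def p_def b_def sum_divide_distrib sum_negf[symmetric]
    by (intro sum.cong refl) (simp add: power2_eq_square diff_divide_distrib mult_ac)
  also have "\<dots> = a * v i - (\<Sum>j\<in>J. b j * v j)"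
    by (simp add: a_def sum_subtractf sum_distrib_right)
  finally have "phi n d x $ i - phi n d y $ i = a * v i - (\<Sum>j\<in>J. b j * v j)"
    using diff by simp
  with a_low b_low one show ?thesis
    unfolding alternating_mean_def J_def[symmetric] v_def by blast
qed

section \<open>Contraction\<close>

lemma ellipticity_pos: "0 < ellipticity R"
  by (simp add: ellipticity_def)

lemma ellipticity_sq_less_one:
  assumes "0 \<le> R"
  shows "(ellipticity R)\<^sup>2 < 1"
proof -
  have "exp (- 4 * R) \<le> 1"
    using assms by simp
  then have "exp (- 4 * R) < 2"
    by linarith
  then have "ellipticity R < 1"
    by (simp add: ellipticity_def)
  then show ?thesis
    using ellipticity_pos[of R] by (simp add: power_less_one_iff abs_square_less_1)
qed

lemma phi_nonexpansive:
  assumes "2 \<le> n" "x \<in> carrier_vec n" "y \<in> carrier_vec n"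
  shows "linf_norm (phi n d x - phi n d y) \<le> linf_norm (x - y)"
proof (rule linf_norm_diff_leI[of _ n])
  fix i assume i: "i < n"
  let ?R = "max (linf_norm x) (linf_norm y)"
  show "\<bar>phi n d x $ i - phi n d y $ i\<bar> \<le> linf_norm (x - y)"
    by (rule alternating_mean_abs_le[OF
          phi_diff_alternating_mean[OF assms(1) i assms(2,3), of ?R] i])
      (use assms ellipticity_pos[of ?R] in \<open>auto intro: abs_diff_index_le_linf_norm\<close>)
qed (use assms in auto)

lemma phi_twice_contraction:
  assumes n: "3 \<le> n" and c: "x \<in> carrier_vec n" "y \<in> carrier_vec n"
    and R: "linf_norm x \<le> R" "linf_norm y \<le> R"
      "linf_norm (phi n d x) \<le> R" "linf_norm (phi n d y) \<le> R"
  shows "linf_norm (phi n d (phi n d x) - phi n d (phi n d y))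
           \<le> (1 - (ellipticity R)\<^sup>2) * linf_norm (x - y)"
proof (rule linf_norm_diff_leI[of _ n])
  fix i assume i: "i < n"
  show "\<bar>phi n d (phi n d x) $ i - phi n d (phi n d y) $ i\<bar>
      \<le> (1 - (ellipticity R)\<^sup>2) * linf_norm (x - y)"
    by (rule alternating_mean_twice_abs_le[OF n i, of _ "\<lambda>j. x $ j - y $ j" _
          "\<lambda>j. phi n d x $ j - phi n d y $ j"])
      (use n i c R ellipticity_pos[of R] in
        \<open>auto intro!: abs_diff_index_le_linf_norm phi_diff_alternating_mean\<close>)
qed (use n in auto)

text \<open>
  The factor \<open>1 / \<theta>\<close> makes up for the odd indices: the step from \<open>0\<close> to \<open>1\<close> gains nothing.
\<close>

lemma geometric_bound_of_two_step:
  fixes u :: "nat \<Rightarrow> real"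
  assumes "0 < \<theta>" "\<theta> < 1" "0 \<le> u 0" "u 1 \<le> u 0" "\<And>k. u (k + 2) \<le> \<theta>\<^sup>2 * u k"
  shows "u k \<le> u 0 / \<theta> * \<theta> ^ k"
proof (induction k rule: nat_induct2)
  case 0
  have "u 0 * \<theta> \<le> u 0 * 1"
    using assms by (intro mult_left_mono) auto
  then show ?case using assms by (simp add: field_simps)
next
  case 1
  then show ?case using assms by simp
next
  case (step k)
  have "u (k + 2) \<le> \<theta>\<^sup>2 * u k"
    by (rule assms)
  also have "\<dots> \<le> \<theta>\<^sup>2 * (u 0 / \<theta> * \<theta> ^ k)"
    using step by (intro mult_left_mono) auto
  also have "\<dots> = u 0 / \<theta> * \<theta> ^ (k + 2)"
    using assms(1) by (simp add: power_add power2_eq_square)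
  finally show ?case by simp
qed

section \<open>Fixed points and solutions\<close>

text \<open>
  Each summand of the equations is less than \<open>1\<close>, so a single summand, or none, cannot reach a
  degree of at least \<open>1\<close>.
\<close>

lemma three_le_of_solution:
  assumes "1 \<le> n" "\<forall>i<n. 1 \<le> d $ i" "solves_ML n d \<beta>"
  shows "3 \<le> n"
proof (rule ccontr)
  assume "\<not> 3 \<le> n"
  with assms(1) consider "n = 1" | "n = 2" by linarith
  then have "(\<Sum>j\<in>{..<n} - {0}. exp (\<beta> $ 0 + \<beta> $ j) / (1 + exp (\<beta> $ 0 + \<beta> $ j))) < 1"
  proof cases
    case 1
    then have empty: "{..<n} - {0} = {}" by auto
    show ?thesis unfolding empty by simp
  next
    case 2
    then have "{..<n} - {0} = {Suc 0}" by auto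
    then show ?thesis by (simp add: add_pos_pos)
  qed
  moreover have "1 \<le> real (d $ 0)"
    using assms(1,2) by simp
  ultimately show False
    using assms(1,3) unfolding solves_ML_def by fastforce
qed

text \<open>
  Pulling \<open>exp (\<beta> $ i)\<close> out of the sum and taking logarithms turns the equations into the fixed
  point equation. The sum has to be nonempty for its logarithm to be meaningful.
\<close>

lemma solution_iff_fixed_point:
  assumes n: "2 \<le> n" and d: "\<forall>i<n. 1 \<le> d $ i" and \<beta>: "\<beta> \<in> carrier_vec n"
  shows "solves_ML n d \<beta> \<longleftrightarrow> phi n d \<beta> = \<beta>"
proof -
  have "real (d $ i) = (\<Sum>j\<in>{..<n} - {i}. exp (\<beta> $ i + \<beta> $ j) / (1 + exp (\<beta> $ i + \<beta> $ j)))
      \<longleftrightarrow> phi n d \<beta> $ i = \<beta> $ i" if i: "i < n" for i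
  proof -
    let ?J = "{..<n} - {i}"
    define S where "S = (\<Sum>j\<in>?J. 1 / (exp (- (\<beta> $ j)) + exp (\<beta> $ i)))"
    have "?J \<noteq> {}"
      using others_nonempty[OF n] .
    then have S: "0 < S"
      unfolding S_def by (intro sum_pos) (auto simp: add_pos_pos)
    have "exp (\<beta> $ i + \<beta> $ j) / (1 + exp (\<beta> $ i + \<beta> $ j))
        = exp (\<beta> $ i) * (1 / (exp (- (\<beta> $ j)) + exp (\<beta> $ i)))" for j
      using exp_gt_zero[of "\<beta> $ j"] exp_gt_zero[of "\<beta> $ i"]
      by (simp add: exp_add exp_minus divide_simps add_pos_pos)
    then have "(\<Sum>j\<in>?J. exp (\<beta> $ i + \<beta> $ j) / (1 + exp (\<beta> $ i + \<beta> $ j))) = exp (\<beta> $ i) * S"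
      by (simp add: S_def sum_distrib_left)
    moreover have "real (d $ i) = exp (\<beta> $ i) * S \<longleftrightarrow> ln (real (d $ i)) = \<beta> $ i + ln S"
    proof -
      have "0 < real (d $ i)" using d i by (auto simp: Suc_le_eq)
      then have "real (d $ i) = exp (\<beta> $ i) * S \<longleftrightarrow> ln (real (d $ i)) = ln (exp (\<beta> $ i) * S)"
        using S by (subst ln_inj_iff) auto
      then show ?thesis using S by (simp add: ln_mult)
    qed
    ultimately show ?thesis
      using i by (auto simp: phi_def S_def)
  qed
  moreover have "phi n d \<beta> = \<beta> \<longleftrightarrow> (\<forall>i<n. phi n d \<beta> $ i = \<beta> $ i)"
    using \<beta> by (metis carrier_vecD eq_vecI phi_carrier)
  ultimately show ?thesis
    using \<beta> by (simp add: solves_ML_def)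
qed

section \<open>Behaviour of the iterates\<close>

text \<open>
  Distances to the fixed point never increase, so \<open>R\<close> bounds the fixed point and all iterates; this
  makes the contraction factor the same at every step.
\<close>

lemma iterate_near_fixed_point:
  assumes n: "3 \<le> n" and \<beta>: "\<beta> \<in> carrier_vec n" "phi n d \<beta> = \<beta>" and x: "x \<in> carrier_vec n"
  defines "R \<equiv> 2 * linf_norm \<beta> + linf_norm x"
  shows "linf_norm (iterate n d x (Suc k) - \<beta>) \<le> linf_norm (iterate n d x k - \<beta>)"
    and "linf_norm (iterate n d x (k + 2) - \<beta>)
           \<le> (1 - (ellipticity R)\<^sup>2) * linf_norm (iterate n d x k - \<beta>)"
proof -
  have step: "linf_norm (iterate n d x (Suc k) - \<beta>) \<le> linf_norm (iterate n d x k - \<beta>)" for k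
    using phi_nonexpansive[of n "iterate n d x k" \<beta> d] n \<beta> x by (simp add: iterate_Suc)
  then show "linf_norm (iterate n d x (Suc k) - \<beta>) \<le> linf_norm (iterate n d x k - \<beta>)" .
  have bound: "linf_norm (iterate n d x k) \<le> R" for k
  proof -
    have "linf_norm (iterate n d x k - \<beta>) \<le> linf_norm (x - \<beta>)"
      by (induction k) (use step order_trans in auto)
    moreover have "linf_norm (x - \<beta>) \<le> linf_norm x + linf_norm \<beta>"
      using n x \<beta> by (intro linf_norm_diff_le) auto
    moreover have "linf_norm (iterate n d x k) \<le> linf_norm (iterate n d x k - \<beta>) + linf_norm \<beta>"
      using n x \<beta> by (intro linf_norm_le_diff_plus) auto
    ultimately show ?thesis by (simp add: R_def)
  qed
  have "linf_norm \<beta> \<le> R"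
    using linf_norm_nonneg[of \<beta> n] linf_norm_nonneg[of x n] n \<beta> x by (simp add: R_def)
  then show "linf_norm (iterate n d x (k + 2) - \<beta>)
      \<le> (1 - (ellipticity R)\<^sup>2) * linf_norm (iterate n d x k - \<beta>)"
    using phi_twice_contraction[OF n, of "iterate n d x k" \<beta> R d] \<beta> x bound[of k] bound[of "Suc k"]
    by (simp add: iterate_Suc)
qed

text \<open>
  Going from \<open>x\<close> to \<open>\<phi>(\<phi>(x))\<close> costs at most \<open>2 |x - \<phi>(x)|\<close>, and \<open>\<phi>(\<phi>(x))\<close> is closer to \<open>\<beta>\<close> than \<open>x\<close>
  is by a fixed factor; this leaves a fixed fraction of \<open>|x - \<beta>|\<close> to be paid by the first part.
\<close>

lemma linf_norm_diff_fixed_point_le: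
  assumes n: "3 \<le> n" and \<beta>: "\<beta> \<in> carrier_vec n" "phi n d \<beta> = \<beta>" and x: "x \<in> carrier_vec n"
  shows "linf_norm (x - \<beta>) \<le> 2 / (ellipticity (2 * linf_norm \<beta> + linf_norm x))\<^sup>2 *
           linf_norm (x - phi n d x)"
proof -
  let ?e = "ellipticity (2 * linf_norm \<beta> + linf_norm x)"
  have "linf_norm (x - \<beta>) \<le> linf_norm (x - phi n d x) + linf_norm (phi n d x - \<beta>)"
    using n x \<beta> by (intro linf_norm_diff_triangle) auto
  moreover have "linf_norm (phi n d x - \<beta>)
      \<le> linf_norm (phi n d x - phi n d (phi n d x)) + linf_norm (phi n d (phi n d x) - \<beta>)"
    using n x \<beta> by (intro linf_norm_diff_triangle) auto
  moreover have "linf_norm (phi n d x - phi n d (phi n d x)) \<le> linf_norm (x - phi n d x)"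
    using n x by (intro phi_nonexpansive) auto
  moreover have "linf_norm (phi n d (phi n d x) - \<beta>) \<le> (1 - ?e\<^sup>2) * linf_norm (x - \<beta>)"
    using iterate_near_fixed_point(2)[OF assms, of 0] by (simp add: iterate_Suc numeral_2_eq_2)
  ultimately have "?e\<^sup>2 * linf_norm (x - \<beta>) \<le> 2 * linf_norm (x - phi n d x)"
    by (simp add: algebra_simps)
  then show ?thesis
    using ellipticity_pos[of "2 * linf_norm \<beta> + linf_norm x"]
    by (simp add: pos_le_divide_eq mult.commute)
qed

text \<open>
  With two vertices, \<open>exp (\<phi>(y) $ 0) = d $ 0 * (exp (- (y $ 1)) + exp (y $ 0))\<close>. If \<open>y $ 1\<close> were always at
  most \<open>R\<close>, then \<open>exp (y $ 0)\<close> would grow by at least \<open>exp (- R)\<close> in each step.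
\<close>

lemma iterate_two_unbounded:
  assumes d: "1 \<le> d $ 0" and x: "x \<in> carrier_vec 2"
  shows "\<exists>k. R < linf_norm (iterate 2 d x k)"
proof (rule ccontr)
  assume "\<not> ?thesis"
  then have R: "linf_norm (iterate 2 d x k) \<le> R" for k
    by (simp add: not_less)
  have grow: "real k * exp (- R) \<le> exp (iterate 2 d x k $ 0)" for k
  proof (induction k)
    case (Suc k)
    let ?y = "iterate 2 d x k"
    have "\<bar>?y $ 1\<bar> \<le> R"
      using abs_index_le_linf_norm[of ?y 2 1] R[of k] x by simp
    then have "exp (- R) \<le> exp (- (?y $ 1))" by simp
    moreover have "real (Suc k) * exp (- R) = real k * exp (- R) + exp (- R)"
      by (simp add: algebra_simps)
    ultimately have "real (Suc k) * exp (- R) \<le> exp (- (?y $ 1)) + exp (?y $ 0)"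
      using Suc.IH by linarith
    also have "\<dots> \<le> real (d $ 0) * (exp (- (?y $ 1)) + exp (?y $ 0))"
      using mult_right_mono[of 1 "real (d $ 0)" "exp (- (?y $ 1)) + exp (?y $ 0)"] d
      by (simp add: add_nonneg_nonneg)
    also have "\<dots> = exp (iterate 2 d x (Suc k) $ 0)"
    proof -
      have "{..<2} - {0} = {1::nat}" by auto
      then show ?thesis
        using d by (simp add: iterate_Suc phi_def exp_diff add_pos_pos)
    qed
    finally show ?case .
  qed simp
  obtain k :: nat where "exp R / exp (- R) < real k"
    using reals_Archimedean2 by blast
  then have "exp R < real k * exp (- R)"
    by (simp add: pos_divide_less_eq)
  then have "exp R < exp (iterate 2 d x k $ 0)"
    using grow[of k] by linarith
  then show False
    using abs_index_le_linf_norm[of "iterate 2 d x k" 2 0] R[of k] x by simp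
qed

text \<open>
  A common bound on the iterates gives a common contraction factor for consecutive iterates, so their
  distances are dominated by a geometric series and each coordinate converges. The limit is fixed
  because \<open>\<phi>\<close> is continuous.
\<close>

lemma bounded_iterates_imp_fixed_point:
  assumes n: "3 \<le> n" and x: "x \<in> carrier_vec n"
    and R: "\<And>k. linf_norm (iterate n d x k) \<le> R"
  obtains \<beta> where "\<beta> \<in> carrier_vec n" "phi n d \<beta> = \<beta>"
proof -
  let ?x = "iterate n d x"
  have xc: "?x k \<in> carrier_vec n" for k using x by simp
  define u where "u k = linf_norm (?x (Suc k) - ?x k)" for k
  define \<theta> where "\<theta> = sqrt (1 - (ellipticity R)\<^sup>2)"
  have "0 \<le> R"
    using linf_norm_nonneg[OF x] n R[of 0] by simp
  then have \<theta>: "0 < \<theta>" "\<theta> < 1" "\<theta>\<^sup>2 = 1 - (ellipticity R)\<^sup>2"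
    using ellipticity_sq_less_one[of R] ellipticity_pos[of R] by (auto simp: \<theta>_def)
  have "u (k + 2) \<le> \<theta>\<^sup>2 * u k" for k
    using phi_twice_contraction[OF n xc xc, of "Suc k" R k d] R[of k] R[of "Suc k"] R[of "Suc (Suc k)"]
    by (simp add: u_def \<theta>(3) iterate_Suc)
  moreover have "u 1 \<le> u 0"
    using phi_nonexpansive[of n "?x 1" "?x 0" d] n xc x by (simp add: u_def iterate_Suc)
  moreover have "0 \<le> u 0"
    using linf_norm_nonneg[of "?x 1 - ?x 0" n] n xc x by (simp add: u_def)
  ultimately have geo: "u k \<le> u 0 / \<theta> * \<theta> ^ k" for k
    using geometric_bound_of_two_step[of \<theta> u k] \<theta> by blast
  have "convergent (\<lambda>k. ?x k $ i)" if i: "i < n" for i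
  proof -
    have "summable (\<lambda>k. ?x (Suc k) $ i - ?x k $ i)"
    proof (rule summable_comparison_test')
      show "summable (\<lambda>k. u 0 / \<theta> * \<theta> ^ k)"
        using \<theta> by (intro summable_mult summable_geometric) auto
      show "norm (?x (Suc k) $ i - ?x k $ i) \<le> u 0 / \<theta> * \<theta> ^ k" if "0 \<le> k" for k
        using abs_diff_index_le_linf_norm[OF xc[of "Suc k"] xc[of k] i] geo[of k] by (simp add: u_def)
    qed
    then have "convergent (\<lambda>m. \<Sum>k<m. ?x (Suc k) $ i - ?x k $ i)"
      by (simp add: summable_iff_convergent)
    then have "convergent (\<lambda>m. ?x m $ i - ?x 0 $ i)"
      by (simp only: sum_lessThan_telescope[of "\<lambda>k. ?x k $ i"])
    then have "convergent (\<lambda>m. (?x m $ i - ?x 0 $ i) + ?x 0 $ i)"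
      by (intro convergent_add convergent_const)
    then show ?thesis by simp
  qed
  then have "\<forall>i. \<exists>l. i < n \<longrightarrow> (\<lambda>k. ?x k $ i) \<longlonglongrightarrow> l"
    by (auto simp: convergent_def)
  then obtain l where l: "\<And>i. i < n \<Longrightarrow> (\<lambda>k. ?x k $ i) \<longlonglongrightarrow> l i"
    by metis
  have "phi n d (vec n l) $ i = l i" if i: "i < n" for i
  proof (rule LIMSEQ_unique)
    let ?J = "{..<n} - {i}"
    have "?J \<noteq> {}"
      using others_nonempty[of n i] n by simp
    then have "0 < (\<Sum>j\<in>?J. 1 / (exp (- l j) + exp (l i)))"
      by (intro sum_pos) (auto simp: add_pos_pos)
    then have "(\<lambda>k. ln (real (d $ i)) - ln (\<Sum>j\<in>?J. 1 / (exp (- (?x k $ j)) + exp (?x k $ i))))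
        \<longlonglongrightarrow> ln (real (d $ i)) - ln (\<Sum>j\<in>?J. 1 / (exp (- l j) + exp (l i)))"
      using i by (intro tendsto_intros l) (auto simp: add_nonneg_eq_0_iff)
    then show "(\<lambda>k. ?x (Suc k) $ i) \<longlonglongrightarrow> phi n d (vec n l) $ i"
      using i by (simp add: iterate_Suc phi_def)
    show "(\<lambda>k. ?x (Suc k) $ i) \<longlonglongrightarrow> l i"
      using l[OF i] by (rule LIMSEQ_Suc)
  qed
  then have "phi n d (vec n l) = vec n l"
    by (intro eq_vecI) (auto simp: phi_def)
  then show ?thesis
    using that[of "vec n l"] by simp
qed

lemma unbounded_imp_divergent_subseq:
  fixes f :: "nat \<Rightarrow> real"
  assumes "\<And>B. \<exists>k. B < f k"
  obtains r :: "nat \<Rightarrow> nat" where "strict_mono r" "filterlim (\<lambda>k. f (r k)) at_top sequentially"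
proof -
  have far: "\<exists>k>m. B < f k" for m B
  proof -
    obtain k where k: "max B (Max (f ` {..m})) < f k"
      using assms by blast
    then have "m < k"
      by (metis Max_ge atMost_iff finite_atMost finite_imageI image_eqI leD linorder_not_less max_less_iff_conj)
    with k show ?thesis by auto
  qed
  obtain r where r: "\<And>k. real k < f (r k)" "\<And>k. r k < r (Suc k)"
    using dependent_nat_choice[of "\<lambda>k m. real k < f m" "\<lambda>k m m'. m < m'"] assms far by metis
  have "filterlim (\<lambda>k. f (r k)) at_top sequentially"
    by (rule filterlim_at_top_mono[OF filterlim_real_sequentially])
      (use r(1) in \<open>auto intro!: always_eventually less_imp_le\<close>)
  moreover have "strict_mono r"
    using r(2) by (simp add: strict_mono_Suc_iff)
  ultimately show ?thesis by (rule that[rotated])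
qed

text \<open>
  For \<open>n = 1\<close> the sums in \<^const>\<open>phi\<close> are empty and, by the convention \<open>ln 0 = 0\<close>, the iterates would
  stay bounded although there is no solution. A vertex of positive degree has a neighbour, which
  excludes this case.
\<close>

lemma degree_sequence_two_le:
  assumes "1 \<le> n" "degree_sequence n d" "1 \<le> d $ 0"
  shows "2 \<le> n"
proof -
  from assms obtain E where "simple_graph {..<n} E" and d: "d $ 0 = degree_in E 0"
    unfolding degree_sequence_def by auto
  moreover obtain e where "e \<in> E"
    using assms(3) unfolding d degree_in_def by (auto dest!: card_ge_0_finite simp: card_gt_0_iff Suc_le_eq)
  ultimately have "e \<subseteq> {..<n}" "card e = 2"
    by (auto simp: simple_graph_def)
  then show ?thesis
    using card_mono[of "{..<n}" e] by simp
qed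

lemma no_solution_imp_unbounded:
  assumes n: "1 \<le> n" "degree_sequence n d" and d: "\<forall>i<n. 1 \<le> d $ i"
    and none: "\<not> (\<exists>\<beta>. solves_ML n d \<beta>)" and x: "x \<in> carrier_vec n"
  shows "\<exists>k. B < linf_norm (iterate n d x k)"
proof -
  have "2 \<le> n" using degree_sequence_two_le[OF n] d n by simp
  then consider "n = 2" | "3 \<le> n" by linarith
  then show ?thesis
  proof cases
    case 1
    then show ?thesis using iterate_two_unbounded[of d x B] d x by simp
  next
    case 2
    show ?thesis
    proof (rule ccontr)
      assume "\<not> ?thesis"
      then obtain \<beta> where "\<beta> \<in> carrier_vec n" "phi n d \<beta> = \<beta>"
        using bounded_iterates_imp_fixed_point[OF 2 x, of d B] by (metis not_less)
      then show False
        using none solution_iff_fixed_point[of n d \<beta>] \<open>2 \<le> n\<close> d by blast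
    qed
  qed
qed

section \<open>Convergence and divergence of the iteration\<close>

theorem theorem1p5:
  shows
    "(\<exists>(K :: real \<times> real \<Rightarrow> real) (\<theta> :: real \<times> real \<Rightarrow> real) (C :: real \<times> real \<Rightarrow> real).
        (\<forall>p. 0 < \<theta> p \<and> \<theta> p < 1) \<and>
        continuous_on ({0..} \<times> {0..}) C \<and>
        (\<forall>n d \<beta>. 1 \<le> n \<longrightarrow> degree_sequence n d \<longrightarrow> (\<forall>i<n. 1 \<le> d $ i) \<longrightarrow> solves_ML n d \<beta> \<longrightarrow>
           phi n d \<beta> = \<beta> \<and>
           (\<forall>x0\<in>carrier_vec n. \<forall>k.
              linf_norm (iterate n d x0 k - \<beta>)
                \<le> K (linf_norm \<beta>, linf_norm x0) * \<theta> (linf_norm \<beta>, linf_norm x0) ^ k) \<and>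
           (\<forall>\<beta>'. solves_ML n d \<beta>' \<longrightarrow> \<beta>' = \<beta>) \<and>
           (\<forall>x0\<in>carrier_vec n.
              linf_norm (x0 - \<beta>)
                \<le> C (linf_norm \<beta>, linf_norm x0) * linf_norm (x0 - iterate n d x0 1))))
     \<and>
     (\<forall>n d x0. 1 \<le> n \<longrightarrow> degree_sequence n d \<longrightarrow> (\<forall>i<n. 1 \<le> d $ i) \<longrightarrow>
        \<not> (\<exists>\<beta>. solves_ML n d \<beta>) \<longrightarrow> x0 \<in> carrier_vec n \<longrightarrow>
        (\<exists>r. strict_mono r \<and> filterlim (\<lambda>k. linf_norm (iterate n d x0 (r k))) at_top sequentially))"
proof (intro conjI)
  \<comment> \<open>The absolute values keep \<open>R\<close> nonnegative, and hence \<open>\<theta>\<close> in the open unit interval, also at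
    pairs that are not pairs of norms.\<close>
  define R :: "real \<times> real \<Rightarrow> real" where "R p = 2 * \<bar>fst p\<bar> + \<bar>snd p\<bar>" for p
  define \<theta> where "\<theta> p = sqrt (1 - (ellipticity (R p))\<^sup>2)" for p
  define K where "K p = (fst p + snd p) / \<theta> p" for p
  define C where "C p = 2 / (ellipticity (R p))\<^sup>2" for p
  have "0 \<le> R p" for p by (simp add: R_def)
  then have \<theta>: "0 < \<theta> p" "\<theta> p < 1" "(\<theta> p)\<^sup>2 = 1 - (ellipticity (R p))\<^sup>2" for p
    using ellipticity_sq_less_one[of "R p"] ellipticity_pos[of "R p"] by (auto simp: \<theta>_def)
  have C: "continuous_on ({0..} \<times> {0..}) C"
    unfolding C_def R_def ellipticity_def by (intro continuous_intros) auto
  have main: "phi n d \<beta> = \<beta> \<and>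
           (\<forall>x0\<in>carrier_vec n. \<forall>k.
              linf_norm (iterate n d x0 k - \<beta>)
                \<le> K (linf_norm \<beta>, linf_norm x0) * \<theta> (linf_norm \<beta>, linf_norm x0) ^ k) \<and>
           (\<forall>\<beta>'. solves_ML n d \<beta>' \<longrightarrow> \<beta>' = \<beta>) \<and>
           (\<forall>x0\<in>carrier_vec n.
              linf_norm (x0 - \<beta>)
                \<le> C (linf_norm \<beta>, linf_norm x0) * linf_norm (x0 - iterate n d x0 1))"
    if n1: "1 \<le> n" and d: "\<forall>i<n. 1 \<le> d $ i" and sol: "solves_ML n d \<beta>" for n d \<beta>
  proof (intro conjI ballI allI impI)
    have n: "3 \<le> n" by (rule three_le_of_solution[OF n1 d sol])
    have \<beta>: "\<beta> \<in> carrier_vec n" using sol by (simp add: solves_ML_def)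
    show fixed: "phi n d \<beta> = \<beta>"
      using solution_iff_fixed_point[OF _ d \<beta>] n sol by simp
    have R_eq: "R (linf_norm \<beta>, linf_norm x) = 2 * linf_norm \<beta> + linf_norm x"
      if "x \<in> carrier_vec n" for x
      using linf_norm_nonneg[OF \<beta> n1] linf_norm_nonneg[OF that n1] by (simp add: R_def)
    show C_bound: "linf_norm (x - \<beta>)
        \<le> C (linf_norm \<beta>, linf_norm x) * linf_norm (x - iterate n d x 1)"
      if x: "x \<in> carrier_vec n" for x
      using linf_norm_diff_fixed_point_le[OF n \<beta> fixed x] by (simp add: C_def R_eq[OF x] iterate_Suc)
    show "linf_norm (iterate n d x k - \<beta>)
        \<le> K (linf_norm \<beta>, linf_norm x) * \<theta> (linf_norm \<beta>, linf_norm x) ^ k"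
      if x: "x \<in> carrier_vec n" for x k
    proof -
      let ?p = "(linf_norm \<beta>, linf_norm x)"
      have "linf_norm (iterate n d x k - \<beta>) \<le> linf_norm (iterate n d x 0 - \<beta>) / \<theta> ?p * \<theta> ?p ^ k"
      proof (rule geometric_bound_of_two_step[where u = "\<lambda>k. linf_norm (iterate n d x k - \<beta>)", OF \<theta>(1,2)])
        show "0 \<le> linf_norm (iterate n d x 0 - \<beta>)"
          using linf_norm_nonneg[of "x - \<beta>" n] n1 x \<beta> by simp
        show "linf_norm (iterate n d x 1 - \<beta>) \<le> linf_norm (iterate n d x 0 - \<beta>)"
          using iterate_near_fixed_point(1)[OF n \<beta> fixed x, of 0] by simp
        show "linf_norm (iterate n d x (k + 2) - \<beta>)
            \<le> (\<theta> ?p)\<^sup>2 * linf_norm (iterate n d x k - \<beta>)" for k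
          unfolding \<theta>(3) R_eq[OF x] by (rule iterate_near_fixed_point(2)[OF n \<beta> fixed x])
      qed
      also have "\<dots> \<le> K ?p * \<theta> ?p ^ k"
        using linf_norm_diff_le[OF x \<beta> n1] \<theta>(1)[of ?p] unfolding K_def
        by (intro mult_right_mono divide_right_mono) auto
      finally show ?thesis .
    qed
    show "\<beta>' = \<beta>" if sol': "solves_ML n d \<beta>'" for \<beta>'
    proof -
      have \<beta>': "\<beta>' \<in> carrier_vec n" using sol' by (simp add: solves_ML_def)
      then have "phi n d \<beta>' = \<beta>'"
        using solution_iff_fixed_point[OF _ d \<beta>'] n sol' by simp
      then have "linf_norm (\<beta>' - \<beta>) \<le> C (linf_norm \<beta>, linf_norm \<beta>') * linf_norm (\<beta>' - \<beta>')"
        using C_bound[OF \<beta>'] by (simp add: iterate_Suc)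
      also have "\<dots> \<le> 0"
      proof (rule mult_nonneg_nonpos)
        show "0 \<le> C (linf_norm \<beta>, linf_norm \<beta>')"
          by (simp add: C_def)
        show "linf_norm (\<beta>' - \<beta>') \<le> 0"
          using \<beta>' n1 by (intro linf_norm_diff_leI[of _ n]) auto
      qed
      finally have "linf_norm (\<beta>' - \<beta>) \<le> 0" .
      then have "\<beta>' $ i = \<beta> $ i" if "i < n" for i
        using abs_diff_index_le_linf_norm[OF \<beta>' \<beta> that] by simp
      then show ?thesis
        using \<beta> \<beta>' by (intro eq_vecI) auto
    qed
  qed
  show "\<exists>(K :: real \<times> real \<Rightarrow> real) (\<theta> :: real \<times> real \<Rightarrow> real) (C :: real \<times> real \<Rightarrow> real).
        (\<forall>p. 0 < \<theta> p \<and> \<theta> p < 1) \<and>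
        continuous_on ({0..} \<times> {0..}) C \<and>
        (\<forall>n d \<beta>. 1 \<le> n \<longrightarrow> degree_sequence n d \<longrightarrow> (\<forall>i<n. 1 \<le> d $ i) \<longrightarrow> solves_ML n d \<beta> \<longrightarrow>
           phi n d \<beta> = \<beta> \<and>
           (\<forall>x0\<in>carrier_vec n. \<forall>k.
              linf_norm (iterate n d x0 k - \<beta>)
                \<le> K (linf_norm \<beta>, linf_norm x0) * \<theta> (linf_norm \<beta>, linf_norm x0) ^ k) \<and>
           (\<forall>\<beta>'. solves_ML n d \<beta>' \<longrightarrow> \<beta>' = \<beta>) \<and>
           (\<forall>x0\<in>carrier_vec n.
              linf_norm (x0 - \<beta>)
                \<le> C (linf_norm \<beta>, linf_norm x0) * linf_norm (x0 - iterate n d x0 1)))"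
    by (rule exI[of _ K], rule exI[of _ \<theta>], rule exI[of _ C], rule conjI,
        simp add: \<theta>(1,2), rule conjI, rule C, intro allI impI, rule main)
next
  show "\<forall>n d x0. 1 \<le> n \<longrightarrow> degree_sequence n d \<longrightarrow> (\<forall>i<n. 1 \<le> d $ i) \<longrightarrow>
        \<not> (\<exists>\<beta>. solves_ML n d \<beta>) \<longrightarrow> x0 \<in> carrier_vec n \<longrightarrow>
        (\<exists>r. strict_mono r \<and> filterlim (\<lambda>k. linf_norm (iterate n d x0 (r k))) at_top sequentially)"
  proof (intro allI impI)
    fix n d and x0 :: "real vec"
    assume "1 \<le> n" "degree_sequence n d" "\<forall>i<n. 1 \<le> d $ i"
      "\<not> (\<exists>\<beta>. solves_ML n d \<beta>)" "x0 \<in> carrier_vec n"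
    then have "\<exists>k. B < linf_norm (iterate n d x0 k)" for B
      by (rule no_solution_imp_unbounded)
    then obtain r where "strict_mono r"
      "filterlim (\<lambda>k. linf_norm (iterate n d x0 (r k))) at_top sequentially"
      by (rule unbounded_imp_divergent_subseq)
    then show "\<exists>r. strict_mono r \<and> filterlim (\<lambda>k. linf_norm (iterate n d x0 (r k))) at_top sequentially"
      by blast
  qed
qed

end
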